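(* Let $G$ be a diffeological group. Then the spherical Milnor space $E^{\mathrm{sph}}(G)$ is smoothly contractible.
   Context: Let $\widetilde E^{\mathrm{sph}}(G)$ be the set of families $(x_i,g_i)_{i\in\mathbb N}$ with $x_i\in\mathbb R$, $g_i\in G$, only finitely many $x_i$ nonzero, and $\sum_i x_i^2=1$. Define $(x_i,g_i)\sim(x_i,g_i')$ iff $g_i=g_i'$ for every $i$ with $x_i\neq 0$ (the coordinates $x_i$ being the same), and $E^{\mathrm{sph}}(G)=\widetilde E^{\mathrm{sph}}(G)/\sim$; classes are written $[(x_i,g_i)]$. For each finite $I\subset\mathbb N$ let $S_I=\{(x_i)_{i\in I}\in\mathbb R^I: \sum_{i\in I}x_i^2=1\}$ with the subset diffeology from $\mathbb R^I$, and let $\psi_I:S_I\times G^I\to E^{\mathrm{sph}}(G)$ send $(x_i,g_i)_{i\in I}$ to the class of the family extended by $x_i=0$ for $i\notin I$ (labels outside $I$ are irrelevant). $E^{\mathrm{sph}}(G)$ carries the final diffeology of the family $(\psi_I)_I$, i.e. the finest diffeology making all $\psi_I$ smooth. A diffeological space $E$ is smoothly contractible if there is a smooth map $H:E\times[0,1]\to E$ (with $[0,1]$ carrying the subset diffeology of $\mathbb R$) such that $H(\cdot,0)=\mathrm{id}_E$ and $H(\cdot,1)$ is constant. *)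

theory Defs
  imports "HOL-Analysis.Analysis" "HOL-Algebra.Group"
begin

text \<open>
  The dimension of the domain of a plot varies, so $\mathbb{R}^n$ is the library's
  \<open>Euclidean_space n\<close>: real sequences vanishing from index \<open>n\<close> on.
  Functions on an open \<open>U\<close> are total functions whose values outside \<open>U\<close> are irrelevant.
\<close>

primrec Ck_on :: "nat \<Rightarrow> nat \<Rightarrow> (nat \<Rightarrow> real) set \<Rightarrow> ((nat \<Rightarrow> real) \<Rightarrow> real) \<Rightarrow> bool" where
  "Ck_on 0 n U f \<longleftrightarrow> continuous_map (subtopology (Euclidean_space n) U) euclideanreal f"
| "Ck_on (Suc k) n U f \<longleftrightarrow>
     continuous_map (subtopology (Euclidean_space n) U) euclideanreal f \<and>
     (\<forall>i<n. \<exists>g. (\<forall>x\<in>U. ((\<lambda>t. f (x(i := t))) has_real_derivative g x) (at (x i))) \<and> Ck_on k n U g)"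

definition smooth_fun_on :: "nat \<Rightarrow> (nat \<Rightarrow> real) set \<Rightarrow> ((nat \<Rightarrow> real) \<Rightarrow> real) \<Rightarrow> bool" where
  "smooth_fun_on n U f \<longleftrightarrow> (\<forall>k. Ck_on k n U f)"

definition smooth_open_map ::
  "nat \<Rightarrow> (nat \<Rightarrow> real) set \<Rightarrow> nat \<Rightarrow> (nat \<Rightarrow> real) set \<Rightarrow> ((nat \<Rightarrow> real) \<Rightarrow> nat \<Rightarrow> real) \<Rightarrow> bool" where
  "smooth_open_map m V n U h \<longleftrightarrow> h \<in> V \<rightarrow> U \<and> (\<forall>i<n. smooth_fun_on m V (\<lambda>v. h v i))"

text \<open>\<open>plots X n U\<close> is the set of plots of \<open>X\<close> with domain \<open>U\<close>, an open subset of $\mathbb{R}^n$.\<close>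

record 'a dspace =
  pts :: "'a set"
  plots :: "nat \<Rightarrow> (nat \<Rightarrow> real) set \<Rightarrow> ((nat \<Rightarrow> real) \<Rightarrow> 'a) set"

text \<open>
  Besides the usual locality condition, the axiom \<open>local\<close> says that being a plot on \<open>U\<close> depends only
  on the values on \<open>U\<close>.
\<close>

locale diffeological_space =
  fixes X :: "'a dspace"
  assumes domain: "p \<in> plots X n U \<Longrightarrow> openin (Euclidean_space n) U"
    and range: "p \<in> plots X n U \<Longrightarrow> p \<in> U \<rightarrow> pts X"
    and const: "c \<in> pts X \<Longrightarrow> openin (Euclidean_space n) U \<Longrightarrow> (\<lambda>_. c) \<in> plots X n U"
    and local: "openin (Euclidean_space n) U \<Longrightarrow>
      (\<And>u. u \<in> U \<Longrightarrow> \<exists>V q. u \<in> V \<and> V \<subseteq> U \<and> q \<in> plots X n V \<and> (\<forall>v\<in>V. q v = p v)) \<Longrightarrow>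
      p \<in> plots X n U"
    and compose: "p \<in> plots X n U \<Longrightarrow> openin (Euclidean_space m) V \<Longrightarrow>
      smooth_open_map m V n U h \<Longrightarrow> p \<circ> h \<in> plots X m V"

definition smooth_map :: "'a dspace \<Rightarrow> 'b dspace \<Rightarrow> ('a \<Rightarrow> 'b) \<Rightarrow> bool" where
  "smooth_map X Y f \<longleftrightarrow>
     f \<in> pts X \<rightarrow> pts Y \<and> (\<forall>n U. \<forall>p\<in>plots X n U. f \<circ> p \<in> plots Y n U)"

definition real_dspace :: "real dspace" where
  "real_dspace =
     \<lparr>pts = UNIV, plots = (\<lambda>n U. {p. openin (Euclidean_space n) U \<and> smooth_fun_on n U p})\<rparr>"

definition sub_dspace :: "'a dspace \<Rightarrow> 'a set \<Rightarrow> 'a dspace" where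
  "sub_dspace X A =
     \<lparr>pts = pts X \<inter> A, plots = (\<lambda>n U. {p \<in> plots X n U. p \<in> U \<rightarrow> A})\<rparr>"

definition prod_dspace :: "'a dspace \<Rightarrow> 'b dspace \<Rightarrow> ('a \<times> 'b) dspace" where
  "prod_dspace X Y =
     \<lparr>pts = pts X \<times> pts Y,
      plots = (\<lambda>n U. {p. fst \<circ> p \<in> plots X n U \<and> snd \<circ> p \<in> plots Y n U})\<rparr>"

definition PiE_dspace :: "'i set \<Rightarrow> ('i \<Rightarrow> 'a dspace) \<Rightarrow> ('i \<Rightarrow> 'a) dspace" where
  "PiE_dspace I X =
     \<lparr>pts = (\<Pi>\<^sub>E i\<in>I. pts (X i)),
      plots = (\<lambda>n U. {p. openin (Euclidean_space n) U \<and> p \<in> U \<rightarrow> (\<Pi>\<^sub>E i\<in>I. pts (X i)) \<and>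
                         (\<forall>i\<in>I. (\<lambda>u. p u i) \<in> plots (X i) n U)})\<rparr>"

text \<open>The finest diffeology on \<open>Y\<close> making the maps \<open>f i : X i \<rightarrow> Y\<close> smooth has as plots the
  common plots of all diffeologies on \<open>Y\<close> with that property.\<close>

definition final_dspace :: "'b set \<Rightarrow> 'i set \<Rightarrow> ('i \<Rightarrow> 'a dspace) \<Rightarrow> ('i \<Rightarrow> 'a \<Rightarrow> 'b) \<Rightarrow> 'b dspace" where
  "final_dspace Y J X f =
     \<lparr>pts = Y,
      plots = (\<lambda>n U. {p. \<forall>Z. diffeological_space Z \<and> pts Z = Y \<and> (\<forall>i\<in>J. smooth_map (X i) Z (f i))
                             \<longrightarrow> p \<in> plots Z n U})\<rparr>"

text \<open>The indiscrete diffeology shows that the above intersection is over a nonempty family.\<close>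

definition indiscrete_dspace :: "'a set \<Rightarrow> 'a dspace" where
  "indiscrete_dspace Y =
     \<lparr>pts = Y, plots = (\<lambda>n U. {p. openin (Euclidean_space n) U \<and> p \<in> U \<rightarrow> Y})\<rparr>"

lemma diffeological_space_indiscrete: "diffeological_space (indiscrete_dspace Y)"
proof
  fix n U p
  assume "openin (Euclidean_space n) U"
    and *: "\<And>u. u \<in> U \<Longrightarrow> \<exists>V q. u \<in> V \<and> V \<subseteq> U \<and> q \<in> plots (indiscrete_dspace Y) n V \<and>
               (\<forall>v\<in>V. q v = p v)"
  moreover have "p u \<in> Y" if "u \<in> U" for u
    using *[OF that] by (force simp: indiscrete_dspace_def Pi_iff)
  ultimately show "p \<in> plots (indiscrete_dspace Y) n U"
    by (auto simp: indiscrete_dspace_def)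
qed (auto simp: indiscrete_dspace_def smooth_open_map_def)

lemma final_dspace_diffeological_space:
  assumes X: "\<And>i. i \<in> J \<Longrightarrow> diffeological_space (X i)"
    and f: "\<And>i. i \<in> J \<Longrightarrow> f i \<in> pts (X i) \<rightarrow> Y"
  shows "diffeological_space (final_dspace Y J X f)"
proof -
  let ?F = "final_dspace Y J X f"
  let ?P = "\<lambda>Z. diffeological_space Z \<and> pts Z = Y \<and> (\<forall>i\<in>J. smooth_map (X i) Z (f i))"
  have plots: "p \<in> plots ?F n U \<longleftrightarrow> (\<forall>Z. ?P Z \<longrightarrow> p \<in> plots Z n U)" for p n U
    by (simp add: final_dspace_def)
  have pts: "pts ?F = Y"
    by (simp add: final_dspace_def)
  have ind: "?P (indiscrete_dspace Y)"
  proof (intro conjI ballI diffeological_space_indiscrete)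
    fix i assume i: "i \<in> J"
    show "smooth_map (X i) (indiscrete_dspace Y) (f i)"
      using f[OF i] diffeological_space.domain[OF X[OF i]] diffeological_space.range[OF X[OF i]]
      by (fastforce simp: smooth_map_def indiscrete_dspace_def Pi_iff)
  qed (simp add: indiscrete_dspace_def)
  show ?thesis
  proof
    fix p n U assume "p \<in> plots ?F n U"
    then have "p \<in> plots (indiscrete_dspace Y) n U"
      using ind plots by blast
    then show "openin (Euclidean_space n) U" "p \<in> U \<rightarrow> pts ?F"
      by (auto simp: indiscrete_dspace_def pts)
  next
    fix c n U assume "c \<in> pts ?F" "openin (Euclidean_space n) U"
    then show "(\<lambda>_. c) \<in> plots ?F n U"
      by (auto simp: plots pts intro: diffeological_space.const)
  next
    fix n U p
    assume U: "openin (Euclidean_space n) U"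
      and *: "\<And>u. u \<in> U \<Longrightarrow> \<exists>V q. u \<in> V \<and> V \<subseteq> U \<and> q \<in> plots ?F n V \<and> (\<forall>v\<in>V. q v = p v)"
    show "p \<in> plots ?F n U"
      unfolding plots
    proof (intro allI impI)
      fix Z assume Z: "?P Z"
      show "p \<in> plots Z n U"
      proof (rule diffeological_space.local[of Z])
        show "\<exists>V q. u \<in> V \<and> V \<subseteq> U \<and> q \<in> plots Z n V \<and> (\<forall>v\<in>V. q v = p v)"
          if u: "u \<in> U" for u
        proof -
          obtain V q where "u \<in> V" "V \<subseteq> U" "q \<in> plots ?F n V" "\<forall>v\<in>V. q v = p v"
            using *[OF u] by blast
          moreover have "q \<in> plots Z n V"
            using \<open>q \<in> plots ?F n V\<close> Z unfolding plots by blast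
          ultimately show ?thesis
            by blast
        qed
      qed (use Z U in auto)
    qed
  next
    fix p n U m V h
    assume "p \<in> plots ?F n U" "openin (Euclidean_space m) V" "smooth_open_map m V n U h"
    then show "p \<circ> h \<in> plots ?F m V"
      unfolding plots by (blast intro: diffeological_space.compose)
  qed
qed

lemma smooth_map_final_dspace:
  assumes "i \<in> J" and "f i \<in> pts (X i) \<rightarrow> Y"
  shows "smooth_map (X i) (final_dspace Y J X f) (f i)"
  using assms by (auto simp: smooth_map_def final_dspace_def)

lemma final_dspace_finest:
  assumes "diffeological_space Z" "pts Z = Y" "\<And>i. i \<in> J \<Longrightarrow> smooth_map (X i) Z (f i)"
  shows "plots (final_dspace Y J X f) n U \<subseteq> plots Z n U"
  using assms by (auto simp: final_dspace_def)

definition smoothly_contractible :: "'a dspace \<Rightarrow> bool" where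
  "smoothly_contractible E \<longleftrightarrow>
     (\<exists>H. smooth_map (prod_dspace E (sub_dspace real_dspace {0..1})) E H \<and>
          (\<forall>e\<in>pts E. H (e, 0) = e) \<and>
          (\<exists>c\<in>pts E. \<forall>e\<in>pts E. H (e, 1) = c))"

locale diffeological_group = group G + diffeological_space X
  for G :: "('a, 'b) monoid_scheme" (structure) and X :: "'a dspace" +
  assumes pts_eq: "pts X = carrier G"
    and smooth_mult: "smooth_map (prod_dspace X X) X (\<lambda>(a, b). a \<otimes> b)"
    and smooth_inv: "smooth_map X X (\<lambda>a. inv a)"

definition sph_families :: "('a, 'b) monoid_scheme \<Rightarrow> (nat \<Rightarrow> real \<times> 'a) set" where
  "sph_families G =
     {a. (\<forall>i. snd (a i) \<in> carrier G) \<and> finite {i. fst (a i) \<noteq> 0} \<and>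
         (\<Sum>i | fst (a i) \<noteq> 0. (fst (a i))\<^sup>2) = 1}"

definition sph_rel ::
  "('a, 'b) monoid_scheme \<Rightarrow> ((nat \<Rightarrow> real \<times> 'a) \<times> (nat \<Rightarrow> real \<times> 'a)) set" where
  "sph_rel G =
     {(a, b). a \<in> sph_families G \<and> b \<in> sph_families G \<and>
              (\<forall>i. fst (a i) = fst (b i) \<and> (fst (a i) \<noteq> 0 \<longrightarrow> snd (a i) = snd (b i)))}"

definition sphere_dspace :: "nat set \<Rightarrow> (nat \<Rightarrow> real) dspace" where
  "sphere_dspace I = sub_dspace (PiE_dspace I (\<lambda>_. real_dspace)) {x. (\<Sum>i\<in>I. (x i)\<^sup>2) = 1}"

text \<open>The label \<open>\<one>\<close> outside \<open>I\<close> is an arbitrary choice that does not affect the class.\<close>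

definition sph_chart ::
  "('a, 'b) monoid_scheme \<Rightarrow> nat set \<Rightarrow> (nat \<Rightarrow> real) \<times> (nat \<Rightarrow> 'a) \<Rightarrow> (nat \<Rightarrow> real \<times> 'a) set" where
  "sph_chart G I = (\<lambda>(x, g). sph_rel G `` {\<lambda>i. if i \<in> I then (x i, g i) else (0, \<one>\<^bsub>G\<^esub>)})"

definition Esph :: "('a, 'b) monoid_scheme \<Rightarrow> 'a dspace \<Rightarrow> (nat \<Rightarrow> real \<times> 'a) set dspace" where
  "Esph G X =
     final_dspace (sph_families G // sph_rel G) {I. finite I}
       (\<lambda>I. prod_dspace (sphere_dspace I) (PiE_dspace I (\<lambda>_. X))) (sph_chart G)"

end

theory Submission
  imports Defs
begin

text \<open>
  The contraction is Milnor's, arranged on the sphere so that every move is smooth. Each slot holds a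
  coordinate and one label, so a coordinate can only be moved, by a quarter turn, to a slot that is
  empty at that moment. To contract to the unit vector in slot \<open>0\<close> with label \<open>\<one>\<close>, slot
  \<open>0\<close> must be emptied first, and for this all coordinates are shifted by one slot, higher slots
  before lower ones. As there is no highest slot, the turns accumulate at time \<open>0\<close>. This does no
  harm: slot \<open>k\<close> is involved in three turns only, and a plot lives locally on finitely many slots.
  When slot \<open>0\<close> is empty, a last turn rotates everything into it.

  The label of a slot is switched after its old content has left, at the moment when the new content
  begins to arrive. The turns are flat at their ends and are separated by pauses, so that the
  coordinate of the slot is zero for a while up to this moment, and zero coordinates forget their
  labels. Hence locally in time the labels may be frozen (\<open>eventually_admissible\<close>, \<open>slot_label_unique\<close>), and on a chart the contraction
  factors locally through a larger chart (\<open>contraction_chart_plot\<close>).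

  It remains to pass from charts to the final diffeology, although the homotopy is defined on a
  product. This is \<open>smooth_map_final_dspace_homotopy\<close>: for any diffeology \<open>Z\<close> that makes the charts
  smooth, the maps whose cylinders are carried by the homotopy to plots of \<open>Z\<close> form again such a
  diffeology.
\<close>

section \<open>Calculus of smooth functions\<close>

lemma Ck_on_continuous:
  "Ck_on k n U f \<Longrightarrow> continuous_map (subtopology (Euclidean_space n) U) euclideanreal f"
  by (cases k) auto

lemma Ck_on_Suc_imp: "Ck_on (Suc k) n U f \<Longrightarrow> Ck_on k n U f"
proof (induction k arbitrary: f)
  case (Suc k)
  have "\<exists>g. (\<forall>x\<in>U. ((\<lambda>t. f (x(i := t))) has_real_derivative g x) (at (x i))) \<and> Ck_on k n U g"
    if "i < n" for i
  proof -
    have "\<exists>g. (\<forall>x\<in>U. ((\<lambda>t. f (x(i := t))) has_real_derivative g x) (at (x i))) \<and> Ck_on (Suc k) n U g"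
      using Ck_on.simps(2)[THEN iffD1, OF Suc.prems] that by blast
    then obtain g where "\<forall>x\<in>U. ((\<lambda>t. f (x(i := t))) has_real_derivative g x) (at (x i))"
      "Ck_on (Suc k) n U g"
      by (elim exE conjE)
    then show ?thesis
      by (intro exI[of _ g] conjI Suc.IH)
  qed
  then show ?case
    using Suc.prems by (auto dest: Ck_on_continuous)
qed (auto dest: Ck_on_continuous)

lemma Ck_on_const: "Ck_on k n U (\<lambda>_. c)"
  by (induction k arbitrary: c) (auto intro!: exI[of _ "\<lambda>_. 0"])

lemma Ck_on_add:
  "Ck_on k n U f \<Longrightarrow> Ck_on k n U g \<Longrightarrow> Ck_on k n U (\<lambda>x. f x + g x)"
proof (induction k arbitrary: f g)
  case (Suc k)
  have "\<exists>h. (\<forall>x\<in>U. ((\<lambda>t. f (x(i := t)) + g (x(i := t))) has_real_derivative h x) (at (x i)))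
          \<and> Ck_on k n U h" if i: "i < n" for i
  proof -
    obtain f' g' where "Ck_on k n U f'" "Ck_on k n U g'"
      "\<forall>x\<in>U. ((\<lambda>t. f (x(i := t))) has_real_derivative f' x) (at (x i))"
      "\<forall>x\<in>U. ((\<lambda>t. g (x(i := t))) has_real_derivative g' x) (at (x i))"
      using Suc.prems i by auto metis
    then show ?thesis
      by (intro exI[of _ "\<lambda>x. f' x + g' x"]) (auto intro!: DERIV_add Suc.IH)
  qed
  then show ?case
    using Suc.prems by (auto intro: continuous_map_add)
qed (auto intro: continuous_map_add)

lemma Ck_on_mult:
  "Ck_on k n U f \<Longrightarrow> Ck_on k n U g \<Longrightarrow> Ck_on k n U (\<lambda>x. f x * g x)"
proof (induction k arbitrary: f g)
  case (Suc k)
  have "\<exists>h. (\<forall>x\<in>U. ((\<lambda>t. f (x(i := t)) * g (x(i := t))) has_real_derivative h x) (at (x i)))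
          \<and> Ck_on k n U h" if i: "i < n" for i
  proof -
    obtain f' g' where *: "Ck_on k n U f'" "Ck_on k n U g'"
      "\<forall>x\<in>U. ((\<lambda>t. f (x(i := t))) has_real_derivative f' x) (at (x i))"
      "\<forall>x\<in>U. ((\<lambda>t. g (x(i := t))) has_real_derivative g' x) (at (x i))"
      using Suc.prems i by auto metis
    have "((\<lambda>t. f (x(i := t)) * g (x(i := t))) has_real_derivative f' x * g x + g' x * f x)
            (at (x i))" if "x \<in> U" for x
      using DERIV_mult[OF *(3)[rule_format, OF that] *(4)[rule_format, OF that]] by simp
    moreover have "Ck_on k n U (\<lambda>x. f' x * g x + g' x * f x)"
      using *(1,2) Suc.prems by (intro Ck_on_add Suc.IH) (blast dest: Ck_on_Suc_imp)+
    ultimately show ?thesis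
      by (intro exI conjI ballI)
  qed
  then show ?case
    using Suc.prems by (auto intro: continuous_map_real_mult)
qed (auto intro: continuous_map_real_mult)

lemma smooth_fun_on_const: "smooth_fun_on n U (\<lambda>_. c)"
  by (simp add: smooth_fun_on_def Ck_on_const)

lemma smooth_fun_on_add:
  "smooth_fun_on n U f \<Longrightarrow> smooth_fun_on n U g \<Longrightarrow> smooth_fun_on n U (\<lambda>x. f x + g x)"
  by (simp add: smooth_fun_on_def Ck_on_add)

lemma smooth_fun_on_mult:
  "smooth_fun_on n U f \<Longrightarrow> smooth_fun_on n U g \<Longrightarrow> smooth_fun_on n U (\<lambda>x. f x * g x)"
  by (simp add: smooth_fun_on_def Ck_on_mult)

lemma continuous_map_Euclidean_space_coord:
  "continuous_map (subtopology (Euclidean_space n) U) euclideanreal (\<lambda>x. x j)"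
  unfolding Euclidean_space_def subtopology_subtopology
  by (intro continuous_map_from_subtopology continuous_map_product_projection) simp

lemma smooth_fun_on_coord: "smooth_fun_on n U (\<lambda>x. x j)"
  unfolding smooth_fun_on_def
proof
  fix k
  have "\<exists>g. (\<forall>x\<in>U. ((\<lambda>t. (x(i := t)) j) has_real_derivative g x) (at (x i))) \<and> Ck_on m n U g"
    for i m
    by (intro exI[of _ "\<lambda>_. if i = j then 1 else 0"])
       (auto intro!: derivative_eq_intros Ck_on_const)
  then show "Ck_on k n U (\<lambda>x. x j)"
    by (cases k) (auto simp: continuous_map_Euclidean_space_coord)
qed

text \<open>
  A smooth outer function is presented as a member of a class \<open>F\<close> that is closed under
  differentiation. This avoids all bookkeeping of higher derivatives: by the chain rule each partial
  derivative is again a member of \<open>F\<close>, composed with \<open>g\<close>, times a partial derivative of \<open>g\<close>.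
\<close>

lemma smooth_fun_on_compose_real:
  assumes F: "\<And>f. f \<in> F \<Longrightarrow> \<exists>f'\<in>F. \<forall>y\<in>S. (f has_real_derivative f' y) (at y)"
    and f: "f \<in> F" and g: "smooth_fun_on n U g" and S: "g \<in> U \<rightarrow> S"
  shows "smooth_fun_on n U (\<lambda>x. f (g x))"
  unfolding smooth_fun_on_def
proof
  fix k show "Ck_on k n U (\<lambda>x. f (g x))"
    using f
  proof (induction k arbitrary: f)
    have cont: "continuous_map (subtopology (Euclidean_space n) U) euclideanreal (\<lambda>x. f (g x))"
      if "f \<in> F" for f
    proof -
      have "continuous_map (top_of_set S) euclideanreal f"
        using F[OF that] by (auto intro!: continuous_at_imp_continuous_on dest: DERIV_isCont)
      moreover have "continuous_map (subtopology (Euclidean_space n) U) (top_of_set S) g"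
        using g S Ck_on_continuous[of 0 n U g]
        by (auto simp: smooth_fun_on_def continuous_map_in_subtopology)
      ultimately show ?thesis
        using continuous_map_compose[of _ _ g _ f] by (simp add: comp_def)
    qed
    {
      case 0
      then show ?case
        using cont by simp
    next
      case (Suc k)
      obtain f' where f': "f' \<in> F" "\<forall>y\<in>S. (f has_real_derivative f' y) (at y)"
        using F[OF Suc.prems] by blast
      have "\<exists>h. (\<forall>x\<in>U. ((\<lambda>t. f (g (x(i := t)))) has_real_derivative h x) (at (x i)))
              \<and> Ck_on k n U h" if i: "i < n" for i
      proof -
        have "Ck_on (Suc k) n U g"
          using g by (simp add: smooth_fun_on_def)
        then obtain g' where g': "Ck_on k n U g'"
          "\<forall>x\<in>U. ((\<lambda>t. g (x(i := t))) has_real_derivative g' x) (at (x i))"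
          using i by auto
        have "((\<lambda>t. f (g (x(i := t)))) has_real_derivative f' (g x) * g' x) (at (x i))"
          if "x \<in> U" for x
          using f'(2) g'(2) S that by (intro DERIV_chain2) auto
        moreover have "Ck_on k n U (\<lambda>x. f' (g x) * g' x)"
          by (intro Ck_on_mult Suc.IH f' g')
        ultimately show ?thesis
          by (intro exI conjI ballI)
      qed
      then show ?case
        using cont Suc.prems by simp
    }
  qed
qed

section \<open>A smooth quarter turn\<close>

text \<open>
  The derivatives of \<open>x \<mapsto> exp (- 1 / x)\<close>, extended by zero to \<open>x \<le> 0\<close>, all have the
  following form for some polynomial \<open>P\<close>.
\<close>

definition flat_fun :: "real poly \<Rightarrow> real \<Rightarrow> real" where
  "flat_fun P x = (if x \<le> 0 then 0 else poly P (1 / x) * exp (- (1 / x)))"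

lemma poly_exp_tendsto_0: "((\<lambda>y::real. poly P y * exp (- y)) \<longlongrightarrow> 0) at_top"
proof -
  have "((\<lambda>y. \<Sum>i\<le>degree P. coeff P i * (y ^ i / exp y)) \<longlongrightarrow> (\<Sum>i\<le>degree P. coeff P i * 0)) at_top"
    by (intro tendsto_intros tendsto_power_div_exp_0)
  then show ?thesis
    by (simp add: poly_altdef sum_distrib_right exp_minus divide_inverse mult.assoc)
qed

lemma flat_fun_has_derivative:
  "(flat_fun P has_real_derivative flat_fun (monom 1 2 * (P - pderiv P)) x) (at x)"
proof -
  consider "x < 0" | "x = 0" | "x > 0"
    by linarith
  then show ?thesis
  proof cases
    case 1
    have "(flat_fun P has_real_derivative 0) (at x)"
      by (rule has_field_derivative_transform_within_open[where S = "{..<0}" and f = "\<lambda>_. 0"])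
         (use 1 in \<open>auto simp: flat_fun_def\<close>)
    then show ?thesis
      using 1 by (simp add: flat_fun_def)
  next
    case 2
    have "((\<lambda>y. flat_fun P y / y) \<longlongrightarrow> 0) (at 0)"
    proof (rule filterlim_split_at)
      show "((\<lambda>y. flat_fun P y / y) \<longlongrightarrow> 0) (at_left 0)"
        by (rule tendsto_eventually)
           (auto simp: flat_fun_def eventually_at_filter)
      have "((\<lambda>y. poly (pCons 0 P) (inverse y) * exp (- inverse y)) \<longlongrightarrow> 0) (at_right 0)"
        by (rule filterlim_compose[OF poly_exp_tendsto_0 filterlim_inverse_at_top_right])
      then show "((\<lambda>y. flat_fun P y / y) \<longlongrightarrow> 0) (at_right 0)"
        by (rule Lim_transform_eventually)
           (auto simp: flat_fun_def eventually_at_filter field_simps)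
    qed
    then show ?thesis
      using 2 by (simp add: has_field_derivative_iff flat_fun_def)
  next
    case 3
    have "((\<lambda>x. poly P (1 / x) * exp (- (1 / x))) has_real_derivative
            flat_fun (monom 1 2 * (P - pderiv P)) x) (at x)"
      using 3
      by (auto intro!: derivative_eq_intros
          simp: flat_fun_def poly_monom field_simps power2_eq_square)
    then show ?thesis
      by (rule has_field_derivative_transform_within_open[where S = "{0<..}"])
         (use 3 in \<open>auto simp: flat_fun_def\<close>)
  qed
qed

definition flat_exp :: "real \<Rightarrow> real" where
  "flat_exp = flat_fun 1"

lemma flat_exp_eq_0: "x \<le> 0 \<Longrightarrow> flat_exp x = 0"
  by (simp add: flat_exp_def flat_fun_def)

lemma flat_exp_pos: "0 < x \<Longrightarrow> 0 < flat_exp x"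
  by (simp add: flat_exp_def flat_fun_def)

lemma smooth_fun_on_flat_exp:
  assumes "smooth_fun_on n U g"
  shows "smooth_fun_on n U (\<lambda>x. flat_exp (g x))"
  unfolding flat_exp_def
proof (rule smooth_fun_on_compose_real[where F = "range flat_fun" and S = UNIV
      and f = "flat_fun 1" and g = g])
  fix f assume "f \<in> range flat_fun"
  then obtain P where "f = flat_fun P"
    by blast
  then show "\<exists>f'\<in>range flat_fun. \<forall>y\<in>UNIV. (f has_real_derivative f' y) (at y)"
    using flat_fun_has_derivative by blast
qed (use assms in auto)

lemma smooth_fun_on_powr:
  assumes "smooth_fun_on n U g" and "g \<in> U \<rightarrow> {0<..}"
  shows "smooth_fun_on n U (\<lambda>x. g x powr r)"
proof (rule smooth_fun_on_compose_real[where F = "range (\<lambda>(c, s) y. c * y powr s)"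
      and S = "{0<..}" and f = "\<lambda>y. y powr r" and g = g])
  fix f :: "real \<Rightarrow> real" assume "f \<in> range (\<lambda>(c, s) y. c * y powr s)"
  then obtain c s where f: "f = (\<lambda>y. c * y powr s)"
    by auto
  have "\<forall>y\<in>{0<..}. (f has_real_derivative (c * s) * y powr (s - 1)) (at y)"
    unfolding f by (auto intro!: derivative_eq_intros)
  then show "\<exists>f'\<in>range (\<lambda>(c, s) y. c * y powr s). \<forall>y\<in>{0<..}. (f has_real_derivative f' y) (at y)"
    by (intro bexI[of _ "\<lambda>y. (c * s) * y powr (s - 1)"]) auto
next
  show "(\<lambda>y. y powr r) \<in> range (\<lambda>(c, s) y. c * y powr s)"
    by (auto intro!: image_eqI[of _ _ "(1, r)"])
qed (use assms in auto)

text \<open>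
  The point \<open>(turn_cos s, turn_sin s)\<close> of the unit circle rests at \<open>(1, 0)\<close> until \<open>s = 0\<close>, moves,
  and rests at \<open>(0, 1)\<close> from \<open>s = 1/2\<close> on.
\<close>

definition turn_norm :: "real \<Rightarrow> real" where
  "turn_norm s = flat_exp (1/2 - s) * flat_exp (1/2 - s) + flat_exp s * flat_exp s"

definition turn_cos :: "real \<Rightarrow> real" where
  "turn_cos s = flat_exp (1/2 - s) * turn_norm s powr (-1/2)"

definition turn_sin :: "real \<Rightarrow> real" where
  "turn_sin s = flat_exp s * turn_norm s powr (-1/2)"

lemma turn_norm_pos: "0 < turn_norm s"
proof -
  have "flat_exp s \<noteq> 0 \<or> flat_exp (1/2 - s) \<noteq> 0"
    using flat_exp_pos[of s] flat_exp_pos[of "1/2 - s"] by linarith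
  then show ?thesis
    unfolding turn_norm_def by (metis sum_squares_gt_zero_iff)
qed

lemma turn_norm_powr: "(turn_norm s powr (-1/2))\<^sup>2 = 1 / turn_norm s"
  using turn_norm_pos[of s] by (simp add: power2_eq_square powr_minus_divide flip: powr_add)

lemma turn_cos_sin_squares: "(turn_cos s)\<^sup>2 + (turn_sin s)\<^sup>2 = 1"
proof -
  have "(turn_cos s)\<^sup>2 + (turn_sin s)\<^sup>2 = turn_norm s * (turn_norm s powr (-1/2))\<^sup>2"
    by (simp add: turn_cos_def turn_sin_def turn_norm_def power2_eq_square algebra_simps)
  also have "\<dots> = 1"
    unfolding turn_norm_powr using turn_norm_pos[of s] by simp
  finally show ?thesis .
qed

lemma turn_sin_eq_0: "s \<le> 0 \<Longrightarrow> turn_sin s = 0"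
  by (simp add: turn_sin_def flat_exp_eq_0)

lemma turn_cos_eq_0: "1/2 \<le> s \<Longrightarrow> turn_cos s = 0"
  by (simp add: turn_cos_def flat_exp_eq_0)

lemma turn_cos_eq_1: "s \<le> 0 \<Longrightarrow> turn_cos s = 1"
proof -
  assume "s \<le> 0"
  then have "(turn_cos s)\<^sup>2 = 1" "0 \<le> turn_cos s"
    using turn_cos_sin_squares[of s] flat_exp_pos[of "1/2 - s"]
    by (auto simp: turn_sin_eq_0 turn_cos_def)
  then show ?thesis
    by (simp add: power2_eq_1_iff)
qed

lemma turn_sin_eq_1: "1/2 \<le> s \<Longrightarrow> turn_sin s = 1"
proof -
  assume "1/2 \<le> s"
  then have "(turn_sin s)\<^sup>2 = 1" "0 \<le> turn_sin s"
    using turn_cos_sin_squares[of s] flat_exp_pos[of s]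
    by (auto simp: turn_cos_eq_0 turn_sin_def)
  then show ?thesis
    by (simp add: power2_eq_1_iff)
qed

lemma smooth_fun_on_turn:
  assumes "smooth_fun_on n U g"
  shows smooth_fun_on_turn_cos: "smooth_fun_on n U (\<lambda>x. turn_cos (g x))"
    and smooth_fun_on_turn_sin: "smooth_fun_on n U (\<lambda>x. turn_sin (g x))"
proof -
  have "smooth_fun_on n U (\<lambda>x. 1/2 + (- 1) * g x)"
    by (intro smooth_fun_on_add smooth_fun_on_mult smooth_fun_on_const assms)
  then have 1: "smooth_fun_on n U (\<lambda>x. flat_exp (1/2 - g x))"
    by (intro smooth_fun_on_flat_exp) simp
  have 2: "smooth_fun_on n U (\<lambda>x. flat_exp (g x))"
    by (rule smooth_fun_on_flat_exp[OF assms])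
  have "smooth_fun_on n U (\<lambda>x. turn_norm (g x))"
    unfolding turn_norm_def by (intro smooth_fun_on_add smooth_fun_on_mult 1 2)
  then have 3: "smooth_fun_on n U (\<lambda>x. turn_norm (g x) powr (-1/2))"
    by (rule smooth_fun_on_powr) (simp add: turn_norm_pos)
  show "smooth_fun_on n U (\<lambda>x. turn_cos (g x))" "smooth_fun_on n U (\<lambda>x. turn_sin (g x))"
    unfolding turn_cos_def turn_sin_def by (intro smooth_fun_on_mult 1 2 3)+
qed

section \<open>Homotopies on a final diffeology\<close>

text \<open>
  The cylinder \<open>U \<times> T\<close> over \<open>U \<subseteq> \<real>\<^sup>n\<close>, with the time \<open>w n\<close> as the last coordinate of a point \<open>w\<close>.
\<close>

definition cylinder :: "nat \<Rightarrow> (nat \<Rightarrow> real) set \<Rightarrow> real set \<Rightarrow> (nat \<Rightarrow> real) set" where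
  "cylinder n U T = {w \<in> topspace (Euclidean_space (Suc n)). w(n := 0) \<in> U \<and> w n \<in> T}"

lemma cylinder_project: "w \<in> cylinder n U T \<Longrightarrow> w(n := 0) \<in> U"
  by (simp add: cylinder_def)

lemma cylinder_mono: "U \<subseteq> U' \<Longrightarrow> T \<subseteq> T' \<Longrightarrow> cylinder n U T \<subseteq> cylinder n U' T'"
  by (auto simp: cylinder_def)

lemma continuous_map_cylinder_project:
  "continuous_map (Euclidean_space (Suc n)) (Euclidean_space n) (\<lambda>w. w(n := 0))"
proof -
  have "continuous_map (Euclidean_space (Suc n)) euclideanreal (\<lambda>w. (w(n := 0)) i)" for i
    using continuous_map_Euclidean_space_coord[of "Suc n" UNIV i] by (cases "i = n") auto
  then have "continuous_map (Euclidean_space (Suc n)) (powertop_real UNIV) (\<lambda>w. w(n := 0))"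
    by (simp add: continuous_map_componentwise_UNIV)
  then show ?thesis
    by (subst (2) Euclidean_space_def)
       (auto simp: continuous_map_in_subtopology topspace_Euclidean_space)
qed

lemma openin_cylinder:
  assumes "openin (Euclidean_space n) U" "open T"
  shows "openin (Euclidean_space (Suc n)) (cylinder n U T)"
proof -
  let ?E = "Euclidean_space (Suc n)"
  have "openin ?E {w \<in> topspace ?E. w(n := 0) \<in> U}"
    using continuous_map_cylinder_project assms(1) by (rule openin_continuous_map_preimage)
  moreover have "openin ?E {w \<in> topspace ?E. w n \<in> T}"
    using continuous_map_Euclidean_space_coord[of "Suc n" UNIV n] assms(2)
    by (intro openin_continuous_map_preimage[where Y = euclideanreal]) auto
  ultimately have "openin ?E ({w \<in> topspace ?E. w(n := 0) \<in> U} \<inter> {w \<in> topspace ?E. w n \<in> T})"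
    by (rule openin_Int)
  then show ?thesis
    by (rule back_subst) (auto simp: cylinder_def)
qed

lemma smooth_fun_on_cylinder:
  assumes "smooth_fun_on n U f"
  shows "smooth_fun_on (Suc n) (cylinder n U T) (\<lambda>w. f (w(n := 0)))"
  unfolding smooth_fun_on_def
proof
  fix k
  have "Ck_on k n U f"
    using assms by (simp add: smooth_fun_on_def)
  then show "Ck_on k (Suc n) (cylinder n U T) (\<lambda>w. f (w(n := 0)))"
  proof (induction k arbitrary: f)
    have proj: "continuous_map (subtopology (Euclidean_space (Suc n)) (cylinder n U T))
                  (subtopology (Euclidean_space n) U) (\<lambda>w. w(n := 0))"
      using continuous_map_cylinder_project
      by (auto simp: continuous_map_in_subtopology continuous_map_from_subtopology cylinder_def)
    have cont: "continuous_map (subtopology (Euclidean_space (Suc n)) (cylinder n U T))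
                  euclideanreal (\<lambda>w. f (w(n := 0)))"
      if "Ck_on k n U f" for k f
      using continuous_map_compose[OF proj Ck_on_continuous[OF that]] by (simp add: comp_def)
    {
      case 0
      then show ?case
        unfolding Ck_on.simps(1)[of "Suc n"] by (rule cont)
    next
      case (Suc k)
      have "\<exists>h. (\<forall>w\<in>cylinder n U T.
                ((\<lambda>t. f ((w(i := t))(n := 0))) has_real_derivative h w) (at (w i)))
              \<and> Ck_on k (Suc n) (cylinder n U T) h" if i: "i < Suc n" for i
      proof (cases "i = n")
        case True
        then show ?thesis
          by (intro exI[of _ "\<lambda>_. 0"]) (simp add: Ck_on_const)
      next
        case False
        then have "i < n"
          using i by simp
        then obtain g where g: "Ck_on k n U g"
          "\<forall>x\<in>U. ((\<lambda>t. f (x(i := t))) has_real_derivative g x) (at (x i))"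
          using Suc.prems by auto
        show ?thesis
        proof (intro exI conjI ballI)
          fix w assume "w \<in> cylinder n U T"
          from g(2)[rule_format, OF cylinder_project[OF this]] False
          show "((\<lambda>t. f ((w(i := t))(n := 0))) has_real_derivative g (w(n := 0))) (at (w i))"
            by (simp add: fun_upd_twist)
        qed (rule Suc.IH[OF g(1)])
      qed
      then show ?case
        unfolding Ck_on.simps(2)[of k "Suc n"] using cont[OF Suc.prems] by blast
    }
  qed
qed

lemma smooth_open_map_cylinder_project:
  "smooth_open_map (Suc n) (cylinder n U T) n U (\<lambda>w. w(n := 0))"
  by (auto simp: smooth_open_map_def smooth_fun_on_coord cylinder_def)

lemma openin_Euclidean_space_zero:
  "openin (Euclidean_space n) U \<Longrightarrow> u \<in> U \<Longrightarrow> u n = 0"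
  using openin_subset[of "Euclidean_space n" U] by (auto simp: topspace_Euclidean_space)

lemma smooth_open_map_cylinder_lift:
  assumes h: "smooth_open_map m V n U h" and U: "openin (Euclidean_space n) U"
  shows "smooth_open_map (Suc m) (cylinder m V T) (Suc n) (cylinder n U T)
           (\<lambda>w. (h (w(m := 0)))(n := w m))"
  unfolding smooth_open_map_def
proof (intro conjI allI impI funcsetI)
  fix w assume w: "w \<in> cylinder m V T"
  then have "h (w(m := 0)) \<in> U"
    using h by (auto simp: smooth_open_map_def cylinder_def)
  then show "(h (w(m := 0)))(n := w m) \<in> cylinder n U T"
    using w openin_subset[OF U] openin_Euclidean_space_zero[OF U]
    by (auto simp: cylinder_def topspace_Euclidean_space fun_upd_idem)
next
  fix i assume "i < Suc n"
  then consider "i = n" | "i < n"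
    by linarith
  then show "smooth_fun_on (Suc m) (cylinder m V T) (\<lambda>w. ((h (w(m := 0)))(n := w m)) i)"
  proof cases
    case 1
    then show ?thesis
      by (simp add: smooth_fun_on_coord)
  next
    case 2
    then have "smooth_fun_on m V (\<lambda>v. h v i)"
      using h by (simp add: smooth_open_map_def)
    from smooth_fun_on_cylinder[OF this] 2 show ?thesis
      by simp
  qed
qed

lemma smooth_open_map_graph:
  assumes U: "openin (Euclidean_space n) U" and s: "smooth_fun_on n U s"
  shows "smooth_open_map n U (Suc n) (cylinder n U UNIV) (\<lambda>u. u(n := s u))"
  unfolding smooth_open_map_def
proof (intro conjI allI impI funcsetI)
  fix u assume "u \<in> U"
  then show "u(n := s u) \<in> cylinder n U UNIV"
    using openin_subset[OF U] openin_Euclidean_space_zero[OF U]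
    by (auto simp: cylinder_def topspace_Euclidean_space fun_upd_idem)
next
  fix i show "smooth_fun_on n U (\<lambda>u. (u(n := s u)) i)"
    using s by (cases "i = n") (auto simp: smooth_fun_on_coord)
qed

context diffeological_space
begin

lemma plots_cong:
  assumes "p \<in> plots X n U" and "\<And>u. u \<in> U \<Longrightarrow> q u = p u"
  shows "q \<in> plots X n U"
proof (rule local[OF domain[OF assms(1)]])
  show "\<exists>V r. u \<in> V \<and> V \<subseteq> U \<and> r \<in> plots X n V \<and> (\<forall>v\<in>V. r v = q v)" if "u \<in> U" for u
    using assms that by (intro exI[of _ U] exI[of _ p]) auto
qed

end

text \<open>
  The condition involves the full cylinder \<open>U \<times> \<real>\<close> because this makes stability under
  reparametrization cheap: a change \<open>h\<close> of the base amounts to precomposing the cylinder with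
  \<open>h \<times> id\<close>, which is absorbed by the diffeology \<open>Z\<close>. In this way no chain rule for functions of
  several variables enters.
\<close>

definition cylinder_dspace :: "'a dspace \<Rightarrow> ('a \<times> real \<Rightarrow> 'a) \<Rightarrow> 'a dspace" where
  "cylinder_dspace Z H =
     \<lparr>pts = pts Z,
      plots = (\<lambda>n U. {q. openin (Euclidean_space n) U \<and> q \<in> U \<rightarrow> pts Z \<and>
                 (\<lambda>w. H (q (w(n := 0)), w n)) \<in> plots Z (Suc n) (cylinder n U UNIV)})\<rparr>"

lemma diffeological_space_cylinder_dspace:
  assumes Z: "diffeological_space Z"
    and const: "\<And>c n U. c \<in> pts Z \<Longrightarrow> openin (Euclidean_space n) U \<Longrightarrow>
      (\<lambda>w. H (c, w n)) \<in> plots Z (Suc n) (cylinder n U UNIV)"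
  shows "diffeological_space (cylinder_dspace Z H)"
proof -
  interpret Z: diffeological_space Z by (fact Z)
  let ?C = "cylinder_dspace Z H"
  show ?thesis
  proof
    fix n U p
    assume U: "openin (Euclidean_space n) U"
      and *: "\<And>u. u \<in> U \<Longrightarrow> \<exists>V q. u \<in> V \<and> V \<subseteq> U \<and> q \<in> plots ?C n V \<and> (\<forall>v\<in>V. q v = p v)"
    have "(\<lambda>w. H (p (w(n := 0)), w n)) \<in> plots Z (Suc n) (cylinder n U UNIV)"
    proof (rule Z.local)
      fix w assume w: "w \<in> cylinder n U UNIV"
      obtain V q where V: "w(n := 0) \<in> V" "V \<subseteq> U" "q \<in> plots ?C n V" "\<forall>v\<in>V. q v = p v"
        using *[OF cylinder_project[OF w]] by blast
      have "w \<in> cylinder n V UNIV"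
        using w V(1) by (simp add: cylinder_def)
      moreover have "(\<lambda>w. H (q (w(n := 0)), w n)) \<in> plots Z (Suc n) (cylinder n V UNIV)"
        using V(3) by (simp add: cylinder_dspace_def)
      moreover have "\<forall>v\<in>cylinder n V UNIV. H (q (v(n := 0)), v n) = H (p (v(n := 0)), v n)"
        using V(4) cylinder_project by fastforce
      ultimately show "\<exists>W r. w \<in> W \<and> W \<subseteq> cylinder n U UNIV \<and> r \<in> plots Z (Suc n) W \<and>
                         (\<forall>v\<in>W. r v = H (p (v(n := 0)), v n))"
        using cylinder_mono[OF V(2) subset_refl] by blast
    qed (simp add: openin_cylinder U)
    moreover have "p \<in> U \<rightarrow> pts Z"
    proof
      fix u assume "u \<in> U"
      then obtain V q where "u \<in> V" "q \<in> plots ?C n V" "\<forall>v\<in>V. q v = p v"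
        using * by blast
      then show "p u \<in> pts Z"
        by (force simp: cylinder_dspace_def Pi_iff)
    qed
    ultimately show "p \<in> plots ?C n U"
      using U by (simp add: cylinder_dspace_def)
  next
    fix p n U m V h
    assume p: "p \<in> plots ?C n U" and V: "openin (Euclidean_space m) V"
      and h: "smooth_open_map m V n U h"
    have U: "openin (Euclidean_space n) U"
      and P: "(\<lambda>w. H (p (w(n := 0)), w n)) \<in> plots Z (Suc n) (cylinder n U UNIV)"
      using p by (auto simp: cylinder_dspace_def)
    have "(\<lambda>w. H (p (w(n := 0)), w n)) \<circ> (\<lambda>w. (h (w(m := 0)))(n := w m))
            \<in> plots Z (Suc m) (cylinder m V UNIV)"
      \<comment> \<open>\<open>h \<times> id\<close> on the cylinders\<close>
      by (rule Z.compose[OF P openin_cylinder[OF V open_UNIV] smooth_open_map_cylinder_lift[OF h U]])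
    then have "(\<lambda>w. H ((p \<circ> h) (w(m := 0)), w m)) \<in> plots Z (Suc m) (cylinder m V UNIV)"
    proof (rule Z.plots_cong)
      fix w assume "w \<in> cylinder m V UNIV"
      then have "h (w(m := 0)) \<in> U"
        using h cylinder_project by (fastforce simp: smooth_open_map_def)
      then show "H ((p \<circ> h) (w(m := 0)), w m) =
          ((\<lambda>w. H (p (w(n := 0)), w n)) \<circ> (\<lambda>w. (h (w(m := 0)))(n := w m))) w"
        using openin_Euclidean_space_zero[OF U] by (simp add: fun_upd_idem)
    qed
    moreover have "p \<circ> h \<in> V \<rightarrow> pts Z"
      using p h by (auto simp: cylinder_dspace_def smooth_open_map_def)
    ultimately show "p \<circ> h \<in> plots ?C m V"
      using V by (simp add: cylinder_dspace_def)
  qed (auto simp: cylinder_dspace_def const)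
qed

text \<open>
  Smoothness of a homotopy on a final diffeology can be tested on the generating maps \<open>f i\<close>. This
  is not immediate, because the diffeology of the product with the interval is not defined as a
  final one. It holds because for each competitor \<open>Z\<close> in the definition of the final diffeology,
  \<open>cylinder_dspace Z H\<close> is a competitor as well. That the homotopy is defined for all real
  times provides open cylinders on which to test it.
\<close>

lemma smooth_map_final_dspace_homotopy:
  assumes const: "\<And>i c n U. i \<in> J \<Longrightarrow> c \<in> pts (X i) \<Longrightarrow> openin (Euclidean_space n) U \<Longrightarrow>
      (\<lambda>_. c) \<in> plots (X i) n U"
    and surj: "Y \<subseteq> (\<Union>i\<in>J. f i ` pts (X i))"
    and H: "H \<in> Y \<times> UNIV \<rightarrow> Y"
    and cyl: "\<And>Z i r n U. diffeological_space Z \<Longrightarrow> pts Z = Y \<Longrightarrow>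
      (\<And>i. i \<in> J \<Longrightarrow> smooth_map (X i) Z (f i)) \<Longrightarrow> i \<in> J \<Longrightarrow> r \<in> plots (X i) n U \<Longrightarrow>
      openin (Euclidean_space n) U \<Longrightarrow>
      (\<lambda>w. H (f i (r (w(n := 0))), w n)) \<in> plots Z (Suc n) (cylinder n U UNIV)"
  shows "smooth_map (prod_dspace (final_dspace Y J X f) (sub_dspace real_dspace A))
           (final_dspace Y J X f) H"
  unfolding smooth_map_def
proof (intro conjI allI ballI)
  let ?E = "final_dspace Y J X f"
  show "H \<in> pts (prod_dspace ?E (sub_dspace real_dspace A)) \<rightarrow> pts ?E"
    using H by (auto simp: prod_dspace_def final_dspace_def)
  fix n U p assume p: "p \<in> plots (prod_dspace ?E (sub_dspace real_dspace A)) n U"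
  then have p1: "fst \<circ> p \<in> plots ?E n U" and U: "openin (Euclidean_space n) U"
    and p2: "smooth_fun_on n U (snd \<circ> p)"
    by (auto simp: prod_dspace_def sub_dspace_def real_dspace_def)
  show "H \<circ> p \<in> plots ?E n U"
    unfolding final_dspace_def
  proof (simp, intro allI impI, elim conjE)
    fix Z assume Z: "diffeological_space Z" "pts Z = Y" "\<forall>i\<in>J. smooth_map (X i) Z (f i)"
    interpret Z: diffeological_space Z by (fact Z)
    let ?C = "cylinder_dspace Z H"
    have cylZ: "(\<lambda>w. H (f i (r (w(n := 0))), w n)) \<in> plots Z (Suc n) (cylinder n U UNIV)"
      if "i \<in> J" "r \<in> plots (X i) n U" "openin (Euclidean_space n) U" for i r n U
      using Z that by (intro cyl) auto
    have "diffeological_space ?C"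
    proof (rule diffeological_space_cylinder_dspace[OF Z(1)])
      fix c n U assume c: "c \<in> pts Z" and U: "openin (Euclidean_space n) U"
      obtain i x where "i \<in> J" "x \<in> pts (X i)" "c = f i x"
        using c surj Z(2) by blast
      then show "(\<lambda>w. H (c, w n)) \<in> plots Z (Suc n) (cylinder n U UNIV)"
        using cylZ[OF _ const] U by blast
    qed
    moreover have "pts ?C = Y"
      using Z(2) by (simp add: cylinder_dspace_def)
    moreover have "smooth_map (X i) ?C (f i)" if i: "i \<in> J" for i
    proof -
      have fi: "f i \<in> pts (X i) \<rightarrow> pts Z"
        "\<And>n U r. r \<in> plots (X i) n U \<Longrightarrow> f i \<circ> r \<in> plots Z n U"
        using Z(3) i by (auto simp: smooth_map_def)
      have "f i \<circ> r \<in> plots ?C n U" if r: "r \<in> plots (X i) n U" for r n U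
        using Z.domain[OF fi(2)[OF r]] Z.range[OF fi(2)[OF r]] cylZ[OF i r]
        by (simp add: cylinder_dspace_def)
      then show ?thesis
        using fi(1) by (auto simp: smooth_map_def cylinder_dspace_def)
    qed
    ultimately have "fst \<circ> p \<in> plots ?C n U"
      using p1 final_dspace_finest[of ?C Y J X f n U] by blast
    then have P: "(\<lambda>w. H (fst (p (w(n := 0))), w n)) \<in> plots Z (Suc n) (cylinder n U UNIV)"
      by (simp add: cylinder_dspace_def)
    \<comment> \<open>The homotopy along \<open>p\<close> is its cylinder, restricted to the graph of the time component.\<close>
    have "(\<lambda>w. H (fst (p (w(n := 0))), w n)) \<circ> (\<lambda>u. u(n := (snd \<circ> p) u)) \<in> plots Z n U"
      by (rule Z.compose[OF P U smooth_open_map_graph[OF U p2]])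
    then show "H \<circ> p \<in> plots Z n U"
      by (rule Z.plots_cong)
         (use openin_Euclidean_space_zero[OF U] in \<open>simp add: fun_upd_idem\<close>)
  qed
qed

section \<open>Sliding the coordinates\<close>

text \<open>
  The quarter turn number \<open>m\<close> runs inside the time interval from \<open>1 / (m + 2)\<close> to
  \<open>1 / (m + 1)\<close> and is over at its midpoint. Turn \<open>0\<close> comes last; infinitely many turns
  accumulate at time \<open>0\<close>.
\<close>

definition slide_cos :: "nat \<Rightarrow> real \<Rightarrow> real" where
  "slide_cos m t = turn_cos ((real m + 1) * ((real m + 2) * t - 1))"

definition slide_sin :: "nat \<Rightarrow> real \<Rightarrow> real" where
  "slide_sin m t = turn_sin ((real m + 1) * ((real m + 2) * t - 1))"

lemma slide_squares: "(slide_cos m t)\<^sup>2 + (slide_sin m t)\<^sup>2 = 1"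
  by (simp add: slide_cos_def slide_sin_def turn_cos_sin_squares)

lemma slide_start:
  assumes "t \<le> 1 / (real m + 2)"
  shows slide_cos_start: "slide_cos m t = 1" and slide_sin_start: "slide_sin m t = 0"
proof -
  have "(real m + 2) * t - 1 \<le> 0"
    using assms by (simp add: field_simps)
  then have "(real m + 1) * ((real m + 2) * t - 1) \<le> 0"
    by (simp add: mult_nonneg_nonpos)
  then show "slide_cos m t = 1" "slide_sin m t = 0"
    by (simp_all add: slide_cos_def slide_sin_def turn_cos_eq_1 turn_sin_eq_0)
qed

lemma slide_end: "slide_cos 0 1 = 0" "slide_sin 0 1 = 1"
  by (simp_all add: slide_cos_def slide_sin_def turn_cos_eq_0 turn_sin_eq_1)

text \<open>
  Turn \<open>m + 1\<close> has been over for a while when turn \<open>m\<close> begins. The first bound below is an open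
  condition on \<open>t\<close>, which is what makes labels locally constant choices.
\<close>

lemma slide_cos_Suc_eq_0:
  assumes "1/2 < (real m + 2) * ((real m + 3) * t - 1)"
  shows "slide_cos (Suc m) t = 0"
  using assms by (simp add: slide_cos_def turn_cos_eq_0 add.commute)

lemma slide_threshold:
  assumes "1 / (real m + 2) \<le> t"
  shows "1/2 < (real m + 2) * ((real m + 3) * t - 1)"
proof -
  have "1 \<le> (real m + 2) * t"
    using assms by (simp add: field_simps)
  then have "(real m + 3) * 1 \<le> (real m + 3) * ((real m + 2) * t)"
    by (intro mult_left_mono) auto
  then show ?thesis
    by (simp add: algebra_simps)
qed

lemma smooth_fun_on_slide:
  assumes "smooth_fun_on n U g"
  shows smooth_fun_on_slide_cos: "smooth_fun_on n U (\<lambda>x. slide_cos m (g x))"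
    and smooth_fun_on_slide_sin: "smooth_fun_on n U (\<lambda>x. slide_sin m (g x))"
proof -
  have "smooth_fun_on n U (\<lambda>x. (real m + 1) * ((real m + 2) * g x + (- 1)))"
    by (intro smooth_fun_on_add smooth_fun_on_mult smooth_fun_on_const assms)
  then have "smooth_fun_on n U (\<lambda>x. (real m + 1) * ((real m + 2) * g x - 1))"
    by simp
  then show "smooth_fun_on n U (\<lambda>x. slide_cos m (g x))" "smooth_fun_on n U (\<lambda>x. slide_sin m (g x))"
    unfolding slide_cos_def slide_sin_def by (rule smooth_fun_on_turn_cos smooth_fun_on_turn_sin)+
qed

text \<open>
  Turn \<open>k + 1\<close> moves the coordinate in slot \<open>k\<close> to the empty slot \<open>k + 1\<close>. After all these, slot \<open>0\<close>
  is empty, and turn \<open>0\<close> rotates everything to the unit vector of slot \<open>0\<close>. So slot \<open>k\<close> first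
  holds what remains of \<open>x k\<close>, the first summand, and later what has arrived from \<open>x (k - 1)\<close>, or
  from the base point if \<open>k = 0\<close>.
\<close>

definition slot_value :: "(nat \<Rightarrow> real) \<Rightarrow> real \<Rightarrow> nat \<Rightarrow> real" where
  "slot_value x t k = slide_cos 0 t * (slide_cos (Suc k) t * x k) +
     (case k of 0 \<Rightarrow> slide_sin 0 t | Suc j \<Rightarrow> slide_cos 0 t * (slide_sin (Suc j) t * x j))"

text \<open>
  The label of slot \<open>k\<close> is the original one if \<open>s k\<close> holds, and that of what arrives otherwise. Such
  a choice \<open>s\<close> is admissible at time \<open>t\<close> if the contribution whose label is dropped vanishes.
\<close>

definition slot_label :: "'a \<Rightarrow> (nat \<Rightarrow> 'a) \<Rightarrow> (nat \<Rightarrow> bool) \<Rightarrow> nat \<Rightarrow> 'a" where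
  "slot_label e g s k = (if s k then g k else case k of 0 \<Rightarrow> e | Suc j \<Rightarrow> g j)"

definition admissible :: "(nat \<Rightarrow> bool) \<Rightarrow> real \<Rightarrow> nat \<Rightarrow> bool" where
  "admissible s t k \<longleftrightarrow> (if s k then slide_sin k t = 0 else slide_cos (Suc k) t = 0)"

definition before_arrival :: "real \<Rightarrow> nat \<Rightarrow> bool" where
  "before_arrival t k \<longleftrightarrow> t < 1 / (real k + 2)"

lemma admissible_before_arrival: "admissible (before_arrival t) t k"
proof (cases "before_arrival t k")
  case False
  then have "slide_cos (Suc k) t = 0"
    by (intro slide_cos_Suc_eq_0 slide_threshold) (simp add: before_arrival_def)
  with False show ?thesis
    by (simp add: admissible_def)
qed (simp add: admissible_def before_arrival_def slide_sin_start)

text \<open>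
  The delicate time \<open>t0\<close> is the threshold itself, where the label has just been switched. There
  the switched label is good already for slightly smaller \<open>t\<close>, because the turn that empties the slot
  came to rest before the threshold.
\<close>

lemma eventually_admissible: "\<forall>\<^sub>F t in nhds t0. admissible (before_arrival t0) t k"
proof (cases "before_arrival t0 k")
  case True
  then have "\<forall>\<^sub>F t in nhds t0. t < 1 / (real k + 2)"
    by (intro eventually_nhds_in_open[of "{..<1 / (real k + 2)}", simplified])
       (auto simp: before_arrival_def)
  then show ?thesis
    by eventually_elim (use True in \<open>simp add: admissible_def slide_sin_start\<close>)
next
  case False
  let ?S = "{t. 1/2 < (real k + 2) * ((real k + 3) * t - 1)}"
  have "open ?S"
    by (intro open_Collect_less continuous_intros)
  moreover have "t0 \<in> ?S"
    using False slide_threshold[of k t0] by (auto simp: before_arrival_def)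
  ultimately have "\<forall>\<^sub>F t in nhds t0. t \<in> ?S"
    by (rule eventually_nhds_in_open)
  then show ?thesis
    by eventually_elim (use False in \<open>simp add: admissible_def slide_cos_Suc_eq_0\<close>)
qed

text \<open>
  Any two admissible choices yield the same labels where it matters: if they differ in a slot, then
  both contributions to this slot vanish.
\<close>

lemma slot_label_unique:
  assumes "admissible s t k" "admissible s' t k" and "slot_value x t k \<noteq> 0"
    and g: "\<And>i. x i \<noteq> 0 \<Longrightarrow> g i = g' i"
  shows "slot_label e g s k = slot_label e g' s' k"
proof (cases k)
  case 0
  then show ?thesis
    using assms by (auto simp: admissible_def slot_label_def slot_value_def split: if_splits)
next
  case (Suc j)
  then show ?thesis
    using assms by (auto simp: admissible_def slot_label_def slot_value_def split: if_splits)
qed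

lemma slot_value_square:
  "(slot_value x t k)\<^sup>2 = (slide_cos 0 t)\<^sup>2 * ((slide_cos (Suc k) t)\<^sup>2 * (x k)\<^sup>2) +
     (case k of 0 \<Rightarrow> (slide_sin 0 t)\<^sup>2
      | Suc j \<Rightarrow> (slide_cos 0 t)\<^sup>2 * ((slide_sin (Suc j) t)\<^sup>2 * (x j)\<^sup>2))"
  using admissible_before_arrival[of t k]
  by (auto simp: slot_value_def admissible_def power2_eq_square split: if_splits nat.split)

lemma slot_value_sum_squares:
  assumes "\<And>i. N \<le> i \<Longrightarrow> x i = 0" and "(\<Sum>i<N. (x i)\<^sup>2) = 1"
  shows "(\<Sum>k\<le>N. (slot_value x t k)\<^sup>2) = 1"
proof -
  let ?c = "\<lambda>m. (slide_cos m t)\<^sup>2" and ?s = "\<lambda>m. (slide_sin m t)\<^sup>2"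
  have "(\<Sum>k\<le>N. (slot_value x t k)\<^sup>2) =
      (\<Sum>k\<le>N. ?c 0 * (?c (Suc k) * (x k)\<^sup>2)) +
      (\<Sum>k\<le>N. case k of 0 \<Rightarrow> ?s 0 | Suc j \<Rightarrow> ?c 0 * (?s (Suc j) * (x j)\<^sup>2))"
    by (simp add: slot_value_square sum.distrib)
  also have "(\<Sum>k\<le>N. ?c 0 * (?c (Suc k) * (x k)\<^sup>2)) = (\<Sum>k<N. ?c 0 * (?c (Suc k) * (x k)\<^sup>2))"
    using assms(1)[of N] by (simp flip: lessThan_Suc_atMost)
  also have "(\<Sum>k\<le>N. case k of 0 \<Rightarrow> ?s 0 | Suc j \<Rightarrow> ?c 0 * (?s (Suc j) * (x j)\<^sup>2)) =
      ?s 0 + (\<Sum>k<N. ?c 0 * (?s (Suc k) * (x k)\<^sup>2))"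
    by (simp add: sum.atMost_shift)
  also have "(\<Sum>k<N. ?c 0 * (?c (Suc k) * (x k)\<^sup>2)) +
      (?s 0 + (\<Sum>k<N. ?c 0 * (?s (Suc k) * (x k)\<^sup>2))) =
      ?s 0 + ?c 0 * (\<Sum>k<N. (?c (Suc k) + ?s (Suc k)) * (x k)\<^sup>2)"
    by (simp add: sum_distrib_left sum.distrib distrib_left distrib_right)
  also have "\<dots> = 1"
    using assms(2) slide_squares[of 0 t] by (simp add: slide_squares add.commute)
  finally show ?thesis .
qed

lemma slot_value_eq_0:
  "(\<And>i. N \<le> i \<Longrightarrow> x i = 0) \<Longrightarrow> N < k \<Longrightarrow> slot_value x t k = 0"
  by (cases k) (simp_all add: slot_value_def)

lemma slot_value_0: "slot_value x 0 k = x k"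
  by (simp add: slot_value_def slide_cos_start slide_sin_start split: nat.split)

lemma slot_value_1: "slot_value x 1 k = (if k = 0 then 1 else 0)"
  by (simp add: slot_value_def slide_end split: nat.split)

section \<open>The contraction of the Milnor space\<close>

lemma sph_families_iff:
  "a \<in> sph_families G \<longleftrightarrow> (\<forall>i. snd (a i) \<in> carrier G) \<and>
     (\<exists>N. (\<forall>i\<ge>N. fst (a i) = 0) \<and> (\<Sum>i<N. (fst (a i))\<^sup>2) = 1)"
proof -
  have sum: "(\<Sum>i | fst (a i) \<noteq> 0. (fst (a i))\<^sup>2) = (\<Sum>i<N. (fst (a i))\<^sup>2)"
    if "\<forall>i\<ge>N. fst (a i) = 0" for N
    using that by (intro sum.mono_neutral_left) (auto simp: not_le[symmetric])
  have "finite {i. fst (a i) \<noteq> 0} \<longleftrightarrow> (\<exists>N. \<forall>i\<ge>N. fst (a i) = 0)"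
    unfolding finite_nat_set_iff_bounded by (auto simp: not_le[symmetric])
  then show ?thesis
    unfolding sph_families_def using sum by auto
qed

lemma equiv_sph_rel: "equiv (sph_families G) (sph_rel G)"
  by (rule equivI) (auto simp: sph_rel_def refl_on_def sym_def trans_def)

definition slide :: "('a, 'b) monoid_scheme \<Rightarrow> (nat \<Rightarrow> real \<times> 'a) \<Rightarrow> real \<Rightarrow> nat \<Rightarrow> real \<times> 'a" where
  "slide G a t = (\<lambda>k. (slot_value (\<lambda>i. fst (a i)) t k,
                        slot_label \<one>\<^bsub>G\<^esub> (\<lambda>i. snd (a i)) (before_arrival t) k))"

definition contraction ::
  "('a, 'b) monoid_scheme \<Rightarrow> (nat \<Rightarrow> real \<times> 'a) set \<times> real \<Rightarrow> (nat \<Rightarrow> real \<times> 'a) set" where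
  "contraction G = (\<lambda>(c, t). sph_rel G `` {slide G (SOME a. a \<in> c) t})"

lemma sph_families_slot_value:
  assumes "a \<in> sph_families G" and "\<And>k. fst (b k) = slot_value (\<lambda>i. fst (a i)) t k"
    and "\<And>k. snd (b k) \<in> carrier G"
  shows "b \<in> sph_families G"
proof -
  obtain N where N: "\<forall>i\<ge>N. fst (a i) = 0" "(\<Sum>i<N. (fst (a i))\<^sup>2) = 1"
    using assms(1) by (auto simp: sph_families_iff)
  have "(\<forall>i\<ge>Suc N. fst (b i) = 0) \<and> (\<Sum>i<Suc N. (fst (b i))\<^sup>2) = 1"
    unfolding assms(2) lessThan_Suc_atMost
    using N slot_value_eq_0[of N "\<lambda>i. fst (a i)"] slot_value_sum_squares[of N "\<lambda>i. fst (a i)"]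
    by (auto simp: Suc_le_eq)
  then show ?thesis
    using assms(3) by (auto simp: sph_families_iff)
qed

text \<open>
  Besides showing that the contraction does not depend on the representative \<open>a\<close>, this lemma lets
  the label be computed with any admissible choice.
\<close>

lemma contraction_eqI:
  assumes G: "group G" and a: "a \<in> sph_families G"
    and val: "\<And>k. fst (b k) = slot_value (\<lambda>i. fst (a i)) t k"
    and carrier: "\<And>k. snd (b k) \<in> carrier G"
    and lab: "\<And>k. slot_value (\<lambda>i. fst (a i)) t k \<noteq> 0 \<Longrightarrow>
      \<exists>s. admissible s t k \<and> snd (b k) = slot_label \<one>\<^bsub>G\<^esub> (\<lambda>i. snd (a i)) s k"
  shows "contraction G (sph_rel G `` {a}, t) = sph_rel G `` {b}"
proof -
  define a' where "a' = (SOME a'. a' \<in> sph_rel G `` {a})"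
  have "a \<in> sph_rel G `` {a}"
    using a by (simp add: sph_rel_def)
  then have "a' \<in> sph_rel G `` {a}"
    unfolding a'_def by (rule someI[where P = "\<lambda>a'. a' \<in> sph_rel G `` {a}"])
  then have a': "a' \<in> sph_families G" and fst: "fst (a' i) = fst (a i)"
    and snd: "fst (a i) \<noteq> 0 \<Longrightarrow> snd (a' i) = snd (a i)" for i
    by (auto simp: sph_rel_def)
  have "\<one>\<^bsub>G\<^esub> \<in> carrier G"
    using G by (simp add: group.is_monoid)
  then have "snd (slide G a' t k) \<in> carrier G" for k
    using a' by (auto simp: slide_def slot_label_def sph_families_def split: nat.split)
  then have "slide G a' t \<in> sph_families G"
    by (intro sph_families_slot_value[OF a']) (auto simp: slide_def)
  moreover have "b \<in> sph_families G"
    using a val carrier by (rule sph_families_slot_value)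
  moreover have "snd (slide G a' t k) = snd (b k)" if nz: "slot_value (\<lambda>i. fst (a i)) t k \<noteq> 0" for k
  proof -
    obtain s where s: "admissible s t k" "snd (b k) = slot_label \<one>\<^bsub>G\<^esub> (\<lambda>i. snd (a i)) s k"
      using lab[OF nz] by blast
    have "slot_label \<one>\<^bsub>G\<^esub> (\<lambda>i. snd (a' i)) (before_arrival t) k =
        slot_label \<one>\<^bsub>G\<^esub> (\<lambda>i. snd (a i)) s k"
      using admissible_before_arrival s(1) nz snd by (rule slot_label_unique)
    then show ?thesis
      using s(2) by (simp add: slide_def)
  qed
  ultimately have "(slide G a' t, b) \<in> sph_rel G"
    by (simp add: sph_rel_def slide_def fst val)
  then have "sph_rel G `` {slide G a' t} = sph_rel G `` {b}"
    by (rule equiv_class_eq[OF equiv_sph_rel])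
  then show ?thesis
    by (simp add: contraction_def a'_def)
qed

lemma contraction_slide:
  assumes "group G" and a: "a \<in> sph_families G"
  shows "slide G a t \<in> sph_families G"
    and "contraction G (sph_rel G `` {a}, t) = sph_rel G `` {slide G a t}"
proof -
  have "\<one>\<^bsub>G\<^esub> \<in> carrier G"
    using assms(1) by (simp add: group.is_monoid)
  then have carrier: "snd (slide G a t k) \<in> carrier G" for k
    using a by (auto simp: slide_def slot_label_def sph_families_def split: nat.split)
  show "slide G a t \<in> sph_families G"
    by (rule sph_families_slot_value[OF a _ carrier]) (simp add: slide_def)
  show "contraction G (sph_rel G `` {a}, t) = sph_rel G `` {slide G a t}"
    by (rule contraction_eqI[OF assms _ carrier])
       (auto simp: slide_def intro: admissible_before_arrival)
qed

lemma sphere_chart_points: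
  assumes "finite I" and "r \<in> pts (prod_dspace (sphere_dspace I) (PiE_dspace I (\<lambda>_. X)))"
    and "pts X = carrier G" and "group G"
  defines "a \<equiv> \<lambda>i. if i \<in> I then (fst r i, snd r i) else (0, \<one>\<^bsub>G\<^esub>)"
  shows "a \<in> sph_families G" and "sph_chart G I r = sph_rel G `` {a}"
    and "I \<subseteq> {..<N} \<Longrightarrow> (\<Sum>i<N. (fst (a i))\<^sup>2) = 1"
proof -
  have sum: "(\<Sum>i<N. (fst (a i))\<^sup>2) = 1" if "I \<subseteq> {..<N}" for N
  proof -
    have "(\<Sum>i<N. (fst (a i))\<^sup>2) = (\<Sum>i\<in>I. (fst r i)\<^sup>2)"
      using that by (intro sum.mono_neutral_cong_right) (auto simp: a_def)
    then show ?thesis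
      using assms(2) by (auto simp: prod_dspace_def sphere_dspace_def sub_dspace_def)
  qed
  then show "I \<subseteq> {..<N} \<Longrightarrow> (\<Sum>i<N. (fst (a i))\<^sup>2) = 1" .
  obtain N where N: "I \<subseteq> {..<N}"
    using assms(1) finite_nat_iff_bounded by blast
  then have zero: "\<forall>i\<ge>N. fst (a i) = 0"
    by (auto simp: a_def)
  have "\<one>\<^bsub>G\<^esub> \<in> carrier G"
    using assms(4) by (simp add: group.is_monoid)
  then have "\<forall>i. snd (a i) \<in> carrier G"
    using assms(2,3) by (auto simp: a_def prod_dspace_def PiE_dspace_def)
  then show "a \<in> sph_families G"
    using sum[OF N] zero by (auto simp: sph_families_iff)
  show "sph_chart G I r = sph_rel G `` {a}"
    by (simp add: sph_chart_def a_def case_prod_beta)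
qed

lemma sphere_chart_surj:
  assumes a: "a \<in> sph_families G" and X: "pts X = carrier G" and G: "group G"
  shows "\<exists>I r. finite I \<and> r \<in> pts (prod_dspace (sphere_dspace I) (PiE_dspace I (\<lambda>_. X))) \<and>
           sph_rel G `` {a} = sph_chart G I r"
proof -
  define I where "I = {i. fst (a i) \<noteq> 0}"
  define r where "r = (restrict (\<lambda>i. fst (a i)) I, restrict (\<lambda>i. snd (a i)) I)"
  let ?b = "\<lambda>i. if i \<in> I then (fst r i, snd r i) else (0, \<one>\<^bsub>G\<^esub>)"
  have I: "finite I" and "(\<Sum>i\<in>I. (fst (a i))\<^sup>2) = 1"
    using a by (simp_all add: sph_families_def I_def)
  then have r: "r \<in> pts (prod_dspace (sphere_dspace I) (PiE_dspace I (\<lambda>_. X)))"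
    using a X by (auto simp: r_def prod_dspace_def sphere_dspace_def sub_dspace_def PiE_dspace_def
        real_dspace_def sph_families_def)
  have "(a, ?b) \<in> sph_rel G"
    using a sphere_chart_points(1)[OF I r X G] by (auto simp: sph_rel_def I_def r_def)
  then have "sph_rel G `` {a} = sph_chart G I r"
    unfolding sphere_chart_points(2)[OF I r X G] by (rule equiv_class_eq[OF equiv_sph_rel])
  with I r show ?thesis
    by blast
qed

text \<open>
  If the slots of \<open>I\<close> are among the first \<open>N\<close>, then the contraction only involves the slots up to
  \<open>N\<close>. In a short time interval around a given time, the labels of these finitely many slots can be
  chosen as at that time. So near each point the contraction factors through the chart of \<open>{..N}\<close>, by
  a map whose coordinates are smooth and whose labels are labels of the given plot or \<open>\<one>\<close>.
\<close>

lemma contraction_chart_plot: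
  assumes "diffeological_group G X" and Z: "diffeological_space Z"
    and charts: "\<And>I. finite I \<Longrightarrow>
      smooth_map (prod_dspace (sphere_dspace I) (PiE_dspace I (\<lambda>_. X))) Z (sph_chart G I)"
    and I: "finite I" and r: "r \<in> plots (prod_dspace (sphere_dspace I) (PiE_dspace I (\<lambda>_. X))) n U"
    and U: "openin (Euclidean_space n) U"
  shows "(\<lambda>w. contraction G (sph_chart G I (r (w(n := 0))), w n))
           \<in> plots Z (Suc n) (cylinder n U UNIV)"
proof -
  interpret diffeological_group G X by (fact assms(1))
  interpret Z: diffeological_space Z by (fact Z)
  define a where "a = (\<lambda>u i. if i \<in> I then (fst (r u) i, snd (r u) i) else (0, \<one>\<^bsub>G\<^esub>))"
  have r_pts: "r u \<in> pts (prod_dspace (sphere_dspace I) (PiE_dspace I (\<lambda>_. X)))" if "u \<in> U" for u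
  proof -
    have "fst (r u) \<in> pts (sphere_dspace I)"
      using r that
      by (simp add: prod_dspace_def sphere_dspace_def sub_dspace_def PiE_dspace_def Pi_iff)
    moreover have "snd (r u) \<in> pts (PiE_dspace I (\<lambda>_. X))"
      using r that by (simp add: prod_dspace_def PiE_dspace_def Pi_iff)
    ultimately show ?thesis
      by (simp add: prod_dspace_def mem_Times_iff)
  qed
  have a: "a u \<in> sph_families G" "sph_chart G I (r u) = sph_rel G `` {a u}"
    "\<And>N. I \<subseteq> {..<N} \<Longrightarrow> (\<Sum>i<N. (fst (a u i))\<^sup>2) = 1" if "u \<in> U" for u
    using sphere_chart_points[OF I r_pts[OF that] pts_eq is_group] by (simp_all add: a_def)
  have smooth_x: "smooth_fun_on (Suc n) (cylinder n U T) (\<lambda>w. fst (a (w(n := 0)) i))" for i T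
  proof (cases "i \<in> I")
    case True
    then have "smooth_fun_on n U (\<lambda>u. fst (r u) i)"
      using r by (simp add: prod_dspace_def sphere_dspace_def sub_dspace_def PiE_dspace_def
          real_dspace_def)
    from smooth_fun_on_cylinder[OF this] True show ?thesis
      by (simp add: a_def)
  qed (simp add: a_def smooth_fun_on_const)
  have plot_g: "(\<lambda>w. snd (a (w(n := 0)) i)) \<in> plots X (Suc n) (cylinder n U T)"
    if "open T" for i T
  proof (cases "i \<in> I")
    case True
    then have "(\<lambda>u. snd (r u) i) \<in> plots X n U"
      using r by (simp add: prod_dspace_def PiE_dspace_def)
    from compose[OF this openin_cylinder[OF U that] smooth_open_map_cylinder_project] True
    show ?thesis
      by (simp add: a_def comp_def)
  next
    case False
    then show ?thesis
      using openin_cylinder[OF U that] by (simp add: a_def const pts_eq)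
  qed
  obtain N where N: "I \<subseteq> {..<N}"
    using I finite_nat_iff_bounded by blast
  then have x_zero: "N \<le> i \<Longrightarrow> fst (a u i) = 0" for u i
    by (auto simp: a_def)
  let ?J = "{..N}"
  show ?thesis
  proof (rule Z.local)
    fix w0 assume w0: "w0 \<in> cylinder n U UNIV"
    define s where "s = before_arrival (w0 n)"
    have "\<forall>\<^sub>F t in nhds (w0 n). \<forall>k\<in>?J. admissible s t k"
      unfolding s_def by (intro eventually_ball_finite ballI eventually_admissible) simp
    then obtain T where T: "open T" "w0 n \<in> T" "\<And>t k. t \<in> T \<Longrightarrow> k \<le> N \<Longrightarrow> admissible s t k"
      unfolding eventually_nhds by auto
    let ?W = "cylinder n U T"
    have W: "openin (Euclidean_space (Suc n)) ?W"
      using openin_cylinder[OF U T(1)] .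
    define y where "y w k = slot_value (\<lambda>i. fst (a (w(n := 0)) i)) (w n) k" for w k
    define l where "l w k = slot_label \<one>\<^bsub>G\<^esub> (\<lambda>i. snd (a (w(n := 0)) i)) s k" for w k
    define R where "R w = (restrict (y w) ?J, restrict (l w) ?J)" for w
    have smooth_y: "smooth_fun_on (Suc n) ?W (\<lambda>w. y w k)" for k
      unfolding y_def slot_value_def
      by (cases k)
         (auto intro!: smooth_fun_on_add smooth_fun_on_mult smooth_fun_on_slide_cos
           smooth_fun_on_slide_sin smooth_fun_on_coord smooth_x simp del: fun_upd_apply)
    have plot_l: "(\<lambda>w. l w k) \<in> plots X (Suc n) ?W" for k
      using plot_g[OF T(1)] const[of "\<one>\<^bsub>G\<^esub>", OF _ W]
      by (cases k; cases "s k") (simp_all add: l_def slot_label_def pts_eq del: fun_upd_apply)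
    have sum_y: "(\<Sum>k\<le>N. (y w k)\<^sup>2) = 1" if "w \<in> ?W" for w
      unfolding y_def using a(3)[OF cylinder_project[OF that] N] x_zero
      by (intro slot_value_sum_squares) auto
    have l_carrier: "l w k \<in> carrier G" if "w \<in> ?W" for w k
      using range[OF plot_l] that by (auto simp: pts_eq)
    have "R \<in> plots (prod_dspace (sphere_dspace ?J) (PiE_dspace ?J (\<lambda>_. X))) (Suc n) ?W"
      using smooth_y plot_l sum_y l_carrier W
      by (simp add: prod_dspace_def sphere_dspace_def sub_dspace_def PiE_dspace_def
          real_dspace_def R_def comp_def pts_eq Pi_iff)
    then have "sph_chart G ?J \<circ> R \<in> plots Z (Suc n) ?W"
      using charts[of ?J] by (simp add: smooth_map_def)
    moreover have "(sph_chart G ?J \<circ> R) w = contraction G (sph_chart G I (r (w(n := 0))), w n)"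
      if w: "w \<in> ?W" for w
    proof -
      note u = cylinder_project[OF w]
      let ?b = "\<lambda>k. if k \<in> ?J then (y w k, l w k) else (0, \<one>\<^bsub>G\<^esub>)"
      have "contraction G (sph_rel G `` {a (w(n := 0))}, w n) = sph_rel G `` {?b}"
      proof (rule contraction_eqI[OF is_group a(1)[OF u]])
        have y_zero: "y w k = 0" if "N < k" for k
          unfolding y_def using x_zero that by (rule slot_value_eq_0)
        then show "fst (?b k) = slot_value (\<lambda>i. fst (a (w(n := 0)) i)) (w n) k" for k
          by (auto simp: y_def simp del: fun_upd_apply)
        show "snd (?b k) \<in> carrier G" for k
          using l_carrier[OF w] by simp
        show "\<exists>s. admissible s (w n) k \<and>
            snd (?b k) = slot_label \<one>\<^bsub>G\<^esub> (\<lambda>i. snd (a (w(n := 0)) i)) s k"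
          if "slot_value (\<lambda>i. fst (a (w(n := 0)) i)) (w n) k \<noteq> 0" for k
        proof -
          have "k \<le> N"
            using that y_zero[of k] by (force simp: y_def simp del: fun_upd_apply)
          then show ?thesis
            using T(3)[of "w n" k] w
            by (intro exI[of _ s]) (simp add: l_def cylinder_def del: fun_upd_apply)
        qed
      qed
      moreover have "sph_chart G ?J (R w) = sph_rel G `` {?b}"
        by (simp add: sph_chart_def R_def cong: if_cong)
      ultimately show ?thesis
        using a(2)[OF u] by simp
    qed
    moreover have "w0 \<in> ?W"
      using w0 T(2) by (simp add: cylinder_def)
    ultimately show "\<exists>V q. w0 \<in> V \<and> V \<subseteq> cylinder n U UNIV \<and> q \<in> plots Z (Suc n) V \<and>
        (\<forall>v\<in>V. q v = contraction G (sph_chart G I (r (v(n := 0))), v n))"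
      using cylinder_mono[of U U T UNIV] by (intro exI[of _ ?W] exI[of _ "sph_chart G ?J \<circ> R"]) auto
  qed (simp add: openin_cylinder U)
qed

theorem theorem4p4:
  fixes G :: "('a, 'b) monoid_scheme" and X :: "'a dspace"
  assumes "diffeological_group G X"
  shows "smoothly_contractible (Esph G X)"
proof -
  interpret diffeological_group G X by (fact assms)
  let ?Y = "sph_families G // sph_rel G"
  let ?C = "\<lambda>I. prod_dspace (sphere_dspace I) (PiE_dspace I (\<lambda>_. X))"
  let ?e = "\<lambda>k::nat. (if k = 0 then 1 else 0 :: real, \<one>\<^bsub>G\<^esub>)"
  have base: "?e \<in> sph_families G"
    unfolding sph_families_iff by (auto intro!: exI[of _ 1])
  have "smooth_map (prod_dspace (Esph G X) (sub_dspace real_dspace {0..1})) (Esph G X)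
          (contraction G)"
    unfolding Esph_def
  proof (rule smooth_map_final_dspace_homotopy)
    fix I c n U
    assume "c \<in> pts (?C I)" and "openin (Euclidean_space n) U"
    then show "(\<lambda>_. c) \<in> plots (?C I) n U"
      by (auto simp: prod_dspace_def sphere_dspace_def sub_dspace_def PiE_dspace_def
          real_dspace_def smooth_fun_on_const comp_def intro!: const)
  next
    show "?Y \<subseteq> (\<Union>I\<in>{I. finite I}. sph_chart G I ` pts (?C I))"
    proof
      fix c assume "c \<in> ?Y"
      then obtain a where "a \<in> sph_families G" "c = sph_rel G `` {a}"
        by (rule quotientE)
      then obtain I r where "finite I" "r \<in> pts (?C I)" "c = sph_chart G I r"
        using sphere_chart_surj[OF _ pts_eq is_group] by metis
      then show "c \<in> (\<Union>I\<in>{I. finite I}. sph_chart G I ` pts (?C I))"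
        by (intro UN_I[of I] image_eqI[of _ _ r]) simp_all
    qed
    show "contraction G \<in> ?Y \<times> UNIV \<rightarrow> ?Y"
    proof clarify
      fix c t assume "c \<in> ?Y"
      then obtain a where "a \<in> sph_families G" "c = sph_rel G `` {a}"
        by (rule quotientE)
      then show "contraction G (c, t) \<in> ?Y"
        using contraction_slide[OF is_group] by (simp add: quotientI)
    qed
  qed (use contraction_chart_plot[OF assms] in auto)
  moreover have "pts (Esph G X) = ?Y"
    by (simp add: Esph_def final_dspace_def)
  moreover have "contraction G (c, 0) = c" if c: "c \<in> ?Y" for c
  proof -
    obtain a where a: "a \<in> sph_families G" "c = sph_rel G `` {a}"
      using c by (rule quotientE)
    have "contraction G (sph_rel G `` {a}, 0) = sph_rel G `` {a}"
      using a(1)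
      by (intro contraction_eqI[OF is_group] exI[of _ "before_arrival 0"] conjI
          admissible_before_arrival)
         (auto simp: slot_value_0 slot_label_def before_arrival_def sph_families_def)
    with a(2) show ?thesis
      by simp
  qed
  moreover have "contraction G (c, 1) = sph_rel G `` {?e}" if c: "c \<in> ?Y" for c
  proof -
    obtain a where a: "a \<in> sph_families G" "c = sph_rel G `` {a}"
      using c by (rule quotientE)
    have "contraction G (sph_rel G `` {a}, 1) = sph_rel G `` {?e}"
      using a(1)
      by (intro contraction_eqI[OF is_group] exI[of _ "before_arrival 1"] conjI
          admissible_before_arrival)
         (auto simp: slot_value_1 slot_label_def before_arrival_def split: if_splits)
    with a(2) show ?thesis
      by simp
  qed
  ultimately show ?thesis
    unfolding smoothly_contractible_def using quotientI[OF base, of "sph_rel G"]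
    by (intro exI[of _ "contraction G"]) auto
qed

end
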